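(* Let $L=(\varphi,\eta)$ be a loop over $\mathcal{V}$, let $q\in\mathbb{Z}[\mathcal{V}]$, and let $x\notin\mathcal{V}$ be a fresh variable. Let $\varphi[q/x]$ be the formula over $\mathcal{V}\cup\{x\}$ obtained from $\varphi$ by replacing occurrences of the polynomial $q$ by $x$ (so that substituting $q$ for $x$ gives back $\varphi$), and let $\eta_x:\mathcal{V}\cup\{x\}\to\mathbb{Z}[\mathcal{V}\cup\{x\}]$ with $\eta_x(v)=\eta(v)$ for $v\in\mathcal{V}$ and $\eta_x(x)=\eta(q)[q/x]$, a polynomial obtained from $\eta(q)$ by replacing occurrences of $q$ by $x$ (so that substituting $q$ for $x$ gives back $\eta(q)$). Let $L_x=(\varphi[q/x],\eta_x)$. Then for all states $\sigma:\mathcal{V}\to\mathbb{Z}$ we have $\mathrm{rc}_L(\sigma)=\mathrm{rc}_{L_x}(\sigma_x)$, where $\sigma_x(v)=\sigma(v)$ for $v\in\mathcal{V}$ and $\sigma_x(x)=\sigma(q)$. Moreover, if $\mathtt{rb}$ is a runtime bound for $L_x$, then $\mathtt{rb}[x/\|q\|]$ is a runtime bound for $L$.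
   Context: A loop $(\varphi,\eta)$ over a finite variable set $\mathcal{V}$ has a guard $\varphi$, a propositional formula built with $\wedge,\vee$ from atoms $p_1<p_2$ with $p_1,p_2\in\mathbb{Z}[\mathcal{V}]$ (other comparisons and negations are expressible this way), and an update $\eta:\mathcal{V}\to\mathbb{Z}[\mathcal{V}]$; $\eta$ is applied to expressions by substituting each variable $v$ by $\eta(v)$ and $\eta^n$ is its $n$-fold application. A state is $\sigma:\mathcal{V}\to\mathbb{Z}$; $|\sigma|$ is the state with $|\sigma|(v)=|\sigma(v)|$. The runtime complexity is $\mathrm{rc}_L(\sigma)=\min\{n\in\mathbb{N}\mid \sigma(\eta^n(\neg\varphi))\text{ holds}\}$, with $\min\emptyset=\omega$. The set $\mathcal{B}$ of bounds is the smallest set containing $\mathbb{R}_{\ge0}\cup\{\omega\}$ and all variables, and closed under $b_1+b_2$, $b_1\cdot b_2$, $k^{b_1}$, $\log_k(\max\{1,b_1\})$ (written $\log_k(b_1)$) and $\max\{b_1,\dots,b_m\}$ for $k\in\mathbb{R}_{>1}$, $m\ge2$. A bound $\mathtt{rb}\in\mathcal{B}$ is a runtime bound for $L$ if $|\sigma|(\mathtt{rb})\ge\mathrm{rc}_L(\sigma)$ for all states $\sigma$. For a polynomial $p=\sum_i c_i\beta_i$ with normalized monomials $\beta_i$, $\|p\|=\sum_i|c_i|\beta_i$. *)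

theory Defs
  imports "HOL-Library.Poly_Mapping" "HOL-Library.Extended_Nonnegative_Real"
begin

type_synonym 'v int_mpoly = "('v \<Rightarrow>\<^sub>0 nat) \<Rightarrow>\<^sub>0 int"

definition poly_vars :: "'v int_mpoly \<Rightarrow> 'v set" where
  "poly_vars p = (\<Union>m\<in>Poly_Mapping.keys p. Poly_Mapping.keys m)"

definition poly_var :: "'v \<Rightarrow> 'v int_mpoly" where
  "poly_var v = Poly_Mapping.single (Poly_Mapping.single v 1) 1"

text \<open>
  Substitution of ring elements for the variables. With values in \<^typ>\<open>'v int_mpoly\<close> this is the
  application of an update to a polynomial, with values in \<^typ>\<open>int\<close> it is the evaluation of a
  polynomial in a state.
\<close>
definition poly_subst :: "('v \<Rightarrow> 'a::comm_ring_1) \<Rightarrow> 'v int_mpoly \<Rightarrow> 'a" where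
  "poly_subst f p = (\<Sum>m\<in>Poly_Mapping.keys p. of_int (Poly_Mapping.lookup p m) *
     (\<Prod>v\<in>Poly_Mapping.keys m. f v ^ Poly_Mapping.lookup m v))"

datatype 'v formula =
    Less "'v int_mpoly" "'v int_mpoly"
  | And "'v formula" "'v formula"
  | Or "'v formula" "'v formula"

primrec formula_vars :: "'v formula \<Rightarrow> 'v set" where
  "formula_vars (Less p r) = poly_vars p \<union> poly_vars r"
| "formula_vars (And \<phi> \<psi>) = formula_vars \<phi> \<union> formula_vars \<psi>"
| "formula_vars (Or \<phi> \<psi>) = formula_vars \<phi> \<union> formula_vars \<psi>"

primrec formula_subst :: "('v \<Rightarrow> 'v int_mpoly) \<Rightarrow> 'v formula \<Rightarrow> 'v formula" where
  "formula_subst \<eta> (Less p r) = Less (poly_subst \<eta> p) (poly_subst \<eta> r)"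
| "formula_subst \<eta> (And \<phi> \<psi>) = And (formula_subst \<eta> \<phi>) (formula_subst \<eta> \<psi>)"
| "formula_subst \<eta> (Or \<phi> \<psi>) = Or (formula_subst \<eta> \<phi>) (formula_subst \<eta> \<psi>)"

text \<open>Over the integers, the negation of \<open>p < r\<close> is \<open>r < p + 1\<close>.\<close>
primrec formula_neg :: "'v formula \<Rightarrow> 'v formula" where
  "formula_neg (Less p r) = Less r (p + 1)"
| "formula_neg (And \<phi> \<psi>) = Or (formula_neg \<phi>) (formula_neg \<psi>)"
| "formula_neg (Or \<phi> \<psi>) = And (formula_neg \<phi>) (formula_neg \<psi>)"

type_synonym 'v state = "'v \<Rightarrow> int"

primrec formula_holds :: "'v state \<Rightarrow> 'v formula \<Rightarrow> bool" where
  "formula_holds \<sigma> (Less p r) \<longleftrightarrow> poly_subst \<sigma> p < poly_subst \<sigma> r"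
| "formula_holds \<sigma> (And \<phi> \<psi>) \<longleftrightarrow> formula_holds \<sigma> \<phi> \<and> formula_holds \<sigma> \<psi>"
| "formula_holds \<sigma> (Or \<phi> \<psi>) \<longleftrightarrow> formula_holds \<sigma> \<phi> \<or> formula_holds \<sigma> \<psi>"

lemma poly_subst_add_1: "poly_subst \<sigma> (p + 1) = poly_subst \<sigma> p + (1 :: int)"
proof -
  define M where "M m = (\<Prod>v\<in>Poly_Mapping.keys m. \<sigma> v ^ Poly_Mapping.lookup m v)"
    for m :: "'a \<Rightarrow>\<^sub>0 nat"
  define A where "A = insert 0 (Poly_Mapping.keys p \<union> Poly_Mapping.keys (p + 1))"
  have fin: "finite A" by (simp add: A_def)
  have ext: "poly_subst \<sigma> r = (\<Sum>m\<in>A. Poly_Mapping.lookup r m * M m)"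
    if "Poly_Mapping.keys r \<subseteq> A" for r
    unfolding poly_subst_def M_def of_int_eq_id id_apply
    by (rule sum.mono_neutral_left[OF fin that]) (auto simp: in_keys_iff)
  have "poly_subst \<sigma> (p + 1) = (\<Sum>m\<in>A. Poly_Mapping.lookup (p + 1) m * M m)"
    by (rule ext) (auto simp: A_def)
  also have "\<dots> = (\<Sum>m\<in>A. Poly_Mapping.lookup p m * M m + (if m = 0 then 1 else 0))"
    by (rule sum.cong)
      (auto simp: lookup_add lookup_one M_def distrib_right when_def)
  also have "\<dots> = poly_subst \<sigma> p + 1"
    using fin by (subst ext) (auto simp: sum.distrib A_def)
  finally show ?thesis .
qed

lemma formula_holds_neg: "formula_holds \<sigma> (formula_neg \<phi>) \<longleftrightarrow> \<not> formula_holds \<sigma> \<phi>"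
  by (induction \<phi>) (auto simp: poly_subst_add_1)

text \<open>
  States and updates over a variable set \<open>V\<close> are total functions on the type of variables; for a
  loop over \<open>V\<close> and bounds over \<open>V\<close>, only their values on \<open>V\<close> are relevant.
\<close>
type_synonym 'v loop = "'v formula \<times> ('v \<Rightarrow> 'v int_mpoly)"

definition loop_over :: "'v set \<Rightarrow> 'v loop \<Rightarrow> bool" where
  "loop_over V L \<longleftrightarrow> finite V \<and> formula_vars (fst L) \<subseteq> V \<and> (\<forall>v\<in>V. poly_vars (snd L v) \<subseteq> V)"

text \<open>The infimum of the empty set is \<^term>\<open>\<infinity> :: enat\<close>, which plays the role of \<open>\<omega>\<close>.\<close>
definition rc :: "'v loop \<Rightarrow> 'v state \<Rightarrow> enat" where
  "rc L \<sigma> = Inf (enat ` {n. formula_holds \<sigma> ((formula_subst (snd L) ^^ n) (formula_neg (fst L)))})"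

text \<open>
  \<open>BExp k b\<close> stands for \<open>k\<close> to the power \<open>b\<close>, and \<open>BLog k b\<close> for the logarithm of
  \<open>max {1, b}\<close> to base \<open>k\<close>. The side conditions on \<open>k\<close> and on the number of
  arguments of a maximum are imposed by the set \<open>bounds\<close> below.
\<close>
datatype 'v bound =
    BConst ennreal
  | BVar 'v
  | BAdd "'v bound" "'v bound"
  | BMult "'v bound" "'v bound"
  | BExp real "'v bound"
  | BLog real "'v bound"
  | BMax "'v bound list"

inductive_set bounds :: "'v set \<Rightarrow> 'v bound set" for V :: "'v set" where
  const: "BConst c \<in> bounds V"
| var: "v \<in> V \<Longrightarrow> BVar v \<in> bounds V"
| add: "b1 \<in> bounds V \<Longrightarrow> b2 \<in> bounds V \<Longrightarrow> BAdd b1 b2 \<in> bounds V"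
| mult: "b1 \<in> bounds V \<Longrightarrow> b2 \<in> bounds V \<Longrightarrow> BMult b1 b2 \<in> bounds V"
| exp: "k > 1 \<Longrightarrow> b \<in> bounds V \<Longrightarrow> BExp k b \<in> bounds V"
| log: "k > 1 \<Longrightarrow> b \<in> bounds V \<Longrightarrow> BLog k b \<in> bounds V"
| max: "length bs \<ge> 2 \<Longrightarrow> (\<forall>b\<in>set bs. b \<in> bounds V) \<Longrightarrow> BMax bs \<in> bounds V"

text \<open>
  Bounds are only evaluated in nonnegative states \<open>\<bar>\<sigma>\<bar>\<close>, so \<^const>\<open>ennreal\<close> does not
  truncate the value of a variable. The product satisfies \<open>0 * \<infinity> = 0\<close>.
\<close>
primrec bound_eval :: "'v state \<Rightarrow> 'v bound \<Rightarrow> ennreal" where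
  "bound_eval \<sigma> (BConst c) = c"
| "bound_eval \<sigma> (BVar v) = ennreal (real_of_int (\<sigma> v))"
| "bound_eval \<sigma> (BAdd b1 b2) = bound_eval \<sigma> b1 + bound_eval \<sigma> b2"
| "bound_eval \<sigma> (BMult b1 b2) = bound_eval \<sigma> b1 * bound_eval \<sigma> b2"
| "bound_eval \<sigma> (BExp k b) =
     (if bound_eval \<sigma> b = \<infinity> then \<infinity> else ennreal (k powr enn2real (bound_eval \<sigma> b)))"
| "bound_eval \<sigma> (BLog k b) =
     (if bound_eval \<sigma> b = \<infinity> then \<infinity> else ennreal (log k (max 1 (enn2real (bound_eval \<sigma> b)))))"
| "bound_eval \<sigma> (BMax bs) = Max (set (map (bound_eval \<sigma>) bs))"

primrec bound_subst :: "'v \<Rightarrow> 'v bound \<Rightarrow> 'v bound \<Rightarrow> 'v bound" where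
  "bound_subst x c (BConst r) = BConst r"
| "bound_subst x c (BVar v) = (if v = x then c else BVar v)"
| "bound_subst x c (BAdd b1 b2) = BAdd (bound_subst x c b1) (bound_subst x c b2)"
| "bound_subst x c (BMult b1 b2) = BMult (bound_subst x c b1) (bound_subst x c b2)"
| "bound_subst x c (BExp k b) = BExp k (bound_subst x c b)"
| "bound_subst x c (BLog k b) = BLog k (bound_subst x c b)"
| "bound_subst x c (BMax bs) = BMax (map (bound_subst x c) bs)"

definition abs_state :: "'v state \<Rightarrow> 'v state" where
  "abs_state \<sigma> = (\<lambda>v. \<bar>\<sigma> v\<bar>)"

definition is_runtime_bound :: "'v set \<Rightarrow> 'v loop \<Rightarrow> 'v bound \<Rightarrow> bool" where
  "is_runtime_bound V L b \<longleftrightarrow>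
     b \<in> bounds V \<and> (\<forall>\<sigma>. bound_eval (abs_state \<sigma>) b \<ge> ennreal_of_enat (rc L \<sigma>))"

text \<open>
  The bound \<open>\<parallel>p\<parallel>\<close> as an expression. Since sums and products of bounds are syntactic, an arbitrary
  enumeration of the monomials and of the variables in them has to be chosen.
\<close>
definition enum_list :: "'a set \<Rightarrow> 'a list" where
  "enum_list A = (SOME xs. set xs = A \<and> distinct xs)"

definition bound_sum :: "'v bound list \<Rightarrow> 'v bound" where
  "bound_sum bs = foldr BAdd bs (BConst 0)"

definition bound_prod :: "'v bound list \<Rightarrow> 'v bound" where
  "bound_prod bs = foldr BMult bs (BConst 1)"

definition monom_bound :: "('v \<Rightarrow>\<^sub>0 nat) \<Rightarrow> 'v bound" where
  "monom_bound m =
     bound_prod (map (\<lambda>v. bound_prod (replicate (Poly_Mapping.lookup m v) (BVar v)))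
                     (enum_list (Poly_Mapping.keys m)))"

definition poly_norm :: "'v int_mpoly \<Rightarrow> 'v bound" where
  "poly_norm p =
     bound_sum (map (\<lambda>m. BMult (BConst (ennreal (real_of_int \<bar>Poly_Mapping.lookup p m\<bar>))) (monom_bound m))
                    (enum_list (Poly_Mapping.keys p)))"

end

theory Submission imports Defs begin

text \<open>
  A formula \<open>\<phi>\<close> after \<open>n\<close> substitutions of the update holds in \<open>\<sigma>\<close> iff \<open>\<phi>\<close> holds in the state
  reached from \<open>\<sigma>\<close> after \<open>n\<close> semantic steps. The relation ``the states agree on \<open>V\<close>, and \<open>x\<close> has the
  value of \<open>q\<close>'' between states of the two loops is preserved by simultaneous steps, because
  substituting \<open>q\<close> for \<open>x\<close> turns the new update of \<open>x\<close> into \<open>\<eta>(q)\<close>; related states satisfy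
  the respective guards simultaneously. The second claim follows since bounds are weakly monotonic
  and \<open>\<bar>\<sigma>(q)\<bar>\<close> is at most the value of \<open>\<parallel>q\<parallel>\<close> in \<open>\<bar>\<sigma>\<bar>\<close>.
\<close>

section \<open>Substitution is a ring homomorphism\<close>

definition monom_subst :: "('v \<Rightarrow> 'a::comm_ring_1) \<Rightarrow> ('v \<Rightarrow>\<^sub>0 nat) \<Rightarrow> 'a" where
  "monom_subst f m = (\<Prod>v\<in>Poly_Mapping.keys m. f v ^ Poly_Mapping.lookup m v)"

lemma poly_subst_alt: "poly_subst f p =
    (\<Sum>m\<in>Poly_Mapping.keys p. of_int (Poly_Mapping.lookup p m) * monom_subst f m)"
  by (simp add: poly_subst_def monom_subst_def)

text \<open>Outside its keys a monomial has exponent 0, so the extra factors are 1. This allows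
  several monomials to be evaluated over one common index set.\<close>

lemma monom_subst_superset:
  assumes "finite A" "Poly_Mapping.keys m \<subseteq> A"
  shows "monom_subst f m = (\<Prod>v\<in>A. f v ^ Poly_Mapping.lookup m v)"
  unfolding monom_subst_def
  by (rule prod.mono_neutral_left) (use assms in \<open>auto simp: in_keys_iff\<close>)

lemma poly_subst_superset:
  assumes "finite A" "Poly_Mapping.keys p \<subseteq> A"
  shows "poly_subst f p = (\<Sum>m\<in>A. of_int (Poly_Mapping.lookup p m) * monom_subst f m)"
  unfolding poly_subst_alt
  by (rule sum.mono_neutral_left) (use assms in \<open>auto simp: in_keys_iff\<close>)

lemma monom_subst_add: "monom_subst f (m + n) = monom_subst f m * monom_subst f n"
proof -
  define A where "A = Poly_Mapping.keys m \<union> Poly_Mapping.keys n"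
  have "finite A" "Poly_Mapping.keys m \<subseteq> A" "Poly_Mapping.keys n \<subseteq> A"
    "Poly_Mapping.keys (m + n) \<subseteq> A"
    using Poly_Mapping.keys_add[of m n] by (auto simp: A_def)
  then show ?thesis
    by (simp add: monom_subst_superset[of A] lookup_add power_add prod.distrib)
qed

lemma poly_subst_add: "poly_subst f (p + r) = poly_subst f p + poly_subst f r"
proof -
  define A where "A = Poly_Mapping.keys p \<union> Poly_Mapping.keys r"
  have "finite A" "Poly_Mapping.keys p \<subseteq> A" "Poly_Mapping.keys r \<subseteq> A"
    "Poly_Mapping.keys (p + r) \<subseteq> A"
    using Poly_Mapping.keys_add[of p r] by (auto simp: A_def)
  then show ?thesis
    by (simp add: poly_subst_superset[of A] lookup_add distrib_right sum.distrib)
qed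

lemma poly_subst_0: "poly_subst f 0 = 0"
  by (simp add: poly_subst_def)

lemma poly_subst_single: "poly_subst f (Poly_Mapping.single m c) = of_int c * monom_subst f m"
  by (simp add: poly_subst_alt)

lemma poly_subst_poly_var: "poly_subst f (poly_var v) = f v"
  by (simp add: poly_var_def poly_subst_single monom_subst_def)

lemma poly_subst_sum: "poly_subst f (\<Sum>i\<in>I. p i) = (\<Sum>i\<in>I. poly_subst f (p i))"
  by (induction I rule: infinite_finite_induct) (auto simp: poly_subst_0 poly_subst_add)

text \<open>Reduces multiplicativity of \<open>poly_subst\<close> to products of single terms, where
  it becomes \<open>monom_subst_add\<close>.\<close>

lemma int_mpoly_eq_sum_single:
  fixes p :: "'v int_mpoly"
  shows "p = (\<Sum>m\<in>Poly_Mapping.keys p. Poly_Mapping.single m (Poly_Mapping.lookup p m))"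
  by (rule poly_mapping_eqI)
    (auto simp: lookup_sum lookup_single when_def sum.delta in_keys_iff)

lemma poly_subst_mult: "poly_subst f (p * r) = poly_subst f p * poly_subst f r"
proof -
  have "p * r = (\<Sum>m\<in>Poly_Mapping.keys p. \<Sum>n\<in>Poly_Mapping.keys r.
      Poly_Mapping.single (m + n) (Poly_Mapping.lookup p m * Poly_Mapping.lookup r n))"
    by (subst int_mpoly_eq_sum_single[of p], subst int_mpoly_eq_sum_single[of r])
      (simp add: sum_product mult_single)
  also have "poly_subst f \<dots> = poly_subst f p * poly_subst f r"
    by (simp add: poly_subst_sum poly_subst_single monom_subst_add poly_subst_alt[of f p]
        poly_subst_alt[of f r] sum_product mult_ac)
  finally show ?thesis .
qed

lemma poly_subst_1: "poly_subst f 1 = 1"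
  using poly_subst_single[of f 0 1] by (simp add: monom_subst_def)

lemma poly_subst_of_int:
  fixes f :: "'v \<Rightarrow> 'a::comm_ring_1"
  shows "poly_subst f (of_int c) = of_int c"
proof -
  have "(of_int c :: 'v int_mpoly) = Poly_Mapping.single 0 (of_int c)"
    by (rule single_of_int[symmetric])
  then show ?thesis
    \<comment> \<open>As a simp rule, \<open>single_of_int\<close> would undo the rewriting by the
      equation just proved.\<close>
    by (simp add: poly_subst_single monom_subst_def del: single_of_int)
qed

lemma poly_subst_power: "poly_subst f (p ^ n) = poly_subst f p ^ n"
  by (induction n) (auto simp: poly_subst_1 poly_subst_mult)

lemma poly_subst_prod: "poly_subst f (\<Prod>i\<in>I. p i) = (\<Prod>i\<in>I. poly_subst f (p i))"
  by (induction I rule: infinite_finite_induct) (auto simp: poly_subst_1 poly_subst_mult)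

text \<open>\<open>poly_subst f\<close> is a ring homomorphism, hence commutes with the sums,
  products and powers that make up \<open>poly_subst g p\<close>. With integer-valued
  \<open>f\<close> this turns a syntactic update into a change of state.\<close>

lemma poly_subst_poly_subst:
  "poly_subst f (poly_subst g p) = poly_subst (\<lambda>v. poly_subst f (g v)) p"
  unfolding poly_subst_def[of g] poly_subst_def[of "\<lambda>v. poly_subst f (g v)"]
  by (simp add: poly_subst_sum poly_subst_mult poly_subst_of_int poly_subst_prod poly_subst_power)

lemma poly_subst_cong:
  assumes "\<And>v. v \<in> poly_vars p \<Longrightarrow> f v = g v"
  shows "poly_subst f p = poly_subst g p"
  unfolding poly_subst_def
  by (intro sum.cong prod.cong arg_cong2[of _ _ _ _ "(*)"] refl arg_cong[of _ _ "\<lambda>y. y ^ _"] assms)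
    (auto simp: poly_vars_def)

section \<open>Runtime complexity via semantic steps\<close>

definition loop_step :: "('v \<Rightarrow> 'v int_mpoly) \<Rightarrow> 'v state \<Rightarrow> 'v state" where
  "loop_step \<eta> \<sigma> = (\<lambda>v. poly_subst \<sigma> (\<eta> v))"

lemma formula_holds_subst:
  "formula_holds \<sigma> (formula_subst \<eta> \<phi>) \<longleftrightarrow> formula_holds (loop_step \<eta> \<sigma>) \<phi>"
  by (induction \<phi>) (auto simp: poly_subst_poly_subst loop_step_def)

text \<open>The outermost substitution acts as the first step. Hence \<sigma> varies in the
  induction, and one step is moved inside the iteration.\<close>

lemma formula_holds_funpow_subst:
  "formula_holds \<sigma> ((formula_subst \<eta> ^^ n) \<phi>) \<longleftrightarrow> formula_holds ((loop_step \<eta> ^^ n) \<sigma>) \<phi>"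
  by (induction n arbitrary: \<sigma>) (auto simp: formula_holds_subst funpow_swap1[of "loop_step \<eta>"])

lemma formula_holds_cong:
  assumes "\<And>v. v \<in> formula_vars \<phi> \<Longrightarrow> \<sigma> v = \<tau> v"
  shows "formula_holds \<sigma> \<phi> \<longleftrightarrow> formula_holds \<tau> \<phi>"
  using assms
proof (induction \<phi>)
  case (Less p r)
  then have "poly_subst \<sigma> p = poly_subst \<tau> p" "poly_subst \<sigma> r = poly_subst \<tau> r"
    by (auto intro: poly_subst_cong)
  then show ?case by simp
qed auto

lemma rc_eq_Inf_loop_step:
  "rc (\<phi>, \<eta>) \<sigma> = Inf (enat ` {n. \<not> formula_holds ((loop_step \<eta> ^^ n) \<sigma>) \<phi>})"
  by (simp add: rc_def formula_holds_funpow_subst formula_holds_neg)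

lemma loop_step_poly_var_upd: "loop_step (poly_var(x := q)) \<sigma> = \<sigma>(x := poly_subst \<sigma> q)"
  by (auto simp: loop_step_def poly_subst_poly_var)

text \<open>Stating the original guard as a substitution instance of \<open>\<phi>x\<close> lets
  \<open>formula_holds_subst\<close> treat it like an update.\<close>

lemma rc_fresh_var:
  assumes upd: "\<And>v. v \<in> V \<Longrightarrow> poly_vars (\<eta> v) \<subseteq> V"
    and x: "x \<notin> V"
    and \<phi>x: "formula_vars \<phi>x \<subseteq> insert x V"
    and \<eta>q: "poly_vars \<eta>q \<subseteq> insert x V"
    and \<eta>q_subst: "poly_subst (poly_var(x := q)) \<eta>q = poly_subst \<eta> q"
  shows "rc (formula_subst (poly_var(x := q)) \<phi>x, \<eta>) \<sigma> =
    rc (\<phi>x, \<eta>(x := \<eta>q)) (\<sigma>(x := poly_subst \<sigma> q))"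
proof -
  \<comment> \<open>Agreement is demanded on \<open>V\<close> only: for other variables
    \<open>\<eta>\<close> is unconstrained and may mention \<open>x\<close>, on which the two states
    can differ.\<close>
  define related where "related \<sigma> \<tau> \<longleftrightarrow> (\<forall>v\<in>V. \<tau> v = \<sigma> v) \<and> \<tau> x = poly_subst \<sigma> q"
    for \<sigma> \<tau> :: "'a state"
  have related_on: "\<tau> v = (\<sigma>(x := poly_subst \<sigma> q)) v"
    if "related \<sigma> \<tau>" "v \<in> insert x V" for \<sigma> \<tau> v
    using that by (auto simp: related_def)
  have step: "related (loop_step \<eta> \<sigma>) (loop_step (\<eta>(x := \<eta>q)) \<tau>)" if rel: "related \<sigma> \<tau>" for \<sigma> \<tau>
  proof -
    have "poly_subst \<tau> (\<eta> v) = poly_subst \<sigma> (\<eta> v)" if "v \<in> V" for v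
      by (rule poly_subst_cong) (use rel upd[OF that] in \<open>auto simp: related_def\<close>)
    moreover have "poly_subst \<tau> \<eta>q = poly_subst (loop_step \<eta> \<sigma>) q"
    proof -
      have "poly_subst \<tau> \<eta>q = poly_subst (\<sigma>(x := poly_subst \<sigma> q)) \<eta>q"
        by (rule poly_subst_cong) (use related_on[OF rel] \<eta>q in blast)
      \<comment> \<open>Setting \<open>x\<close> to the value of \<open>q\<close> is the semantic
        step of the substitution \<open>poly_var(x := q)\<close>; the syntactic form is what
        \<open>\<eta>q_subst\<close> speaks of.\<close>
      also have "\<dots> = poly_subst \<sigma> (poly_subst (poly_var(x := q)) \<eta>q)"
        by (simp add: poly_subst_poly_subst flip: loop_step_poly_var_upd) (simp add: loop_step_def)
      also have "\<dots> = poly_subst (loop_step \<eta> \<sigma>) q"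
        by (simp only: \<eta>q_subst poly_subst_poly_subst loop_step_def)
      finally show ?thesis .
    qed
    ultimately show ?thesis
      using x by (auto simp: related_def loop_step_def)
  qed
  have "related \<sigma> (\<sigma>(x := poly_subst \<sigma> q))"
    using x by (auto simp: related_def)
  then have rel: "related ((loop_step \<eta> ^^ n) \<sigma>)
      ((loop_step (\<eta>(x := \<eta>q)) ^^ n) (\<sigma>(x := poly_subst \<sigma> q)))" for n
    by (induction n) (auto intro: step)
  have guard: "formula_holds \<sigma> (formula_subst (poly_var(x := q)) \<phi>x) \<longleftrightarrow> formula_holds \<tau> \<phi>x"
    if "related \<sigma> \<tau>" for \<sigma> \<tau>
    unfolding formula_holds_subst loop_step_poly_var_upd
    by (rule formula_holds_cong) (use related_on[OF that] \<phi>x in \<open>metis subsetD\<close>)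
  show ?thesis
    unfolding rc_eq_Inf_loop_step by (simp only: guard[OF rel])
qed

section \<open>Substitution into bounds\<close>

lemma
  assumes "finite A"
  shows set_enum_list: "set (enum_list A) = A" and distinct_enum_list: "distinct (enum_list A)"
  using someI_ex[OF finite_distinct_list[OF assms]] by (auto simp: enum_list_def)

lemma bound_eval_bound_sum:
  "bound_eval \<sigma> (bound_sum bs) = (\<Sum>b\<leftarrow>bs. bound_eval \<sigma> b)"
  by (induction bs) (auto simp: bound_sum_def)

lemma bound_eval_bound_prod:
  "bound_eval \<sigma> (bound_prod bs) = (\<Prod>b\<leftarrow>bs. bound_eval \<sigma> b)"
  by (induction bs) (auto simp: bound_prod_def)

lemma bound_sum_in_bounds: "set bs \<subseteq> bounds V \<Longrightarrow> bound_sum bs \<in> bounds V"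
  by (induction bs) (auto simp: bound_sum_def intro: bounds.intros)

lemma bound_prod_in_bounds: "set bs \<subseteq> bounds V \<Longrightarrow> bound_prod bs \<in> bounds V"
  by (induction bs) (auto simp: bound_prod_def intro: bounds.intros)

lemma poly_norm_in_bounds:
  assumes "poly_vars p \<subseteq> V"
  shows "poly_norm p \<in> bounds V"
  unfolding poly_norm_def monom_bound_def
  using assms
  by (fastforce intro!: bound_sum_in_bounds bound_prod_in_bounds bounds.intros
      simp: set_enum_list poly_vars_def)

lemma bound_eval_monom_bound:
  assumes "\<And>v. \<sigma> v \<ge> 0"
  shows "bound_eval \<sigma> (monom_bound m) = ennreal (real_of_int (monom_subst \<sigma> m))"
proof -
  have "bound_eval \<sigma> (monom_bound m) =
      (\<Prod>v\<in>Poly_Mapping.keys m. ennreal (real_of_int (\<sigma> v)) ^ Poly_Mapping.lookup m v)"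
    unfolding monom_bound_def bound_eval_bound_prod
    by (simp add: o_def bound_eval_bound_prod prod_list_replicate set_enum_list distinct_enum_list
        prod.distinct_set_conv_list[symmetric])
  then show ?thesis
    using assms by (simp add: monom_subst_def ennreal_power prod_ennreal)
qed

text \<open>Since \<open>ennreal\<close> truncates negative numbers to 0, nonnegativity of the state
  is what lets it commute with the sums and products.\<close>

lemma bound_eval_poly_norm:
  assumes "\<And>v. \<sigma> v \<ge> 0"
  shows "bound_eval \<sigma> (poly_norm p) = ennreal (real_of_int
    (\<Sum>m\<in>Poly_Mapping.keys p. \<bar>Poly_Mapping.lookup p m\<bar> * monom_subst \<sigma> m))"
proof -
  have nonneg: "monom_subst \<sigma> m \<ge> 0" for m
    using assms by (simp add: monom_subst_def prod_nonneg)
  have "bound_eval \<sigma> (poly_norm p) = (\<Sum>m\<in>Poly_Mapping.keys p.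
      ennreal (real_of_int \<bar>Poly_Mapping.lookup p m\<bar>) * ennreal (real_of_int (monom_subst \<sigma> m)))"
    unfolding poly_norm_def bound_eval_bound_sum
    by (simp add: o_def bound_eval_monom_bound[OF assms] set_enum_list distinct_enum_list
        sum.distinct_set_conv_list[symmetric])
  then show ?thesis
    using nonneg by (simp add: sum_ennreal flip: ennreal_mult)
qed

lemma abs_monom_subst: "\<bar>monom_subst \<sigma> m\<bar> = monom_subst (abs_state \<sigma>) m"
proof -
  have "\<bar>\<Prod>v\<in>A. \<sigma> v ^ n v\<bar> = (\<Prod>v\<in>A. \<bar>\<sigma> v\<bar> ^ n v)" for A and n :: "'a \<Rightarrow> nat"
    by (induction A rule: infinite_finite_induct) (auto simp: abs_mult power_abs)
  then show ?thesis
    by (simp add: monom_subst_def abs_state_def)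
qed

text \<open>Triangle inequality over the monomials, combined with multiplicativity of the absolute
  value inside each monomial.\<close>

lemma abs_poly_subst_le_poly_norm:
  "ennreal (real_of_int \<bar>poly_subst \<sigma> p\<bar>) \<le> bound_eval (abs_state \<sigma>) (poly_norm p)"
proof -
  have "\<bar>poly_subst \<sigma> p\<bar> \<le> (\<Sum>m\<in>Poly_Mapping.keys p. \<bar>Poly_Mapping.lookup p m * monom_subst \<sigma> m\<bar>)"
    unfolding poly_subst_alt by simp
  also have "\<dots> = (\<Sum>m\<in>Poly_Mapping.keys p.
      \<bar>Poly_Mapping.lookup p m\<bar> * monom_subst (abs_state \<sigma>) m)"
    by (simp add: abs_mult abs_monom_subst)
  finally show ?thesis
    by (subst bound_eval_poly_norm)
      (simp add: abs_state_def, intro ennreal_leI of_int_le_iff[THEN iffD2])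
qed

lemma bound_subst_in_bounds:
  assumes "b \<in> bounds (insert x V)" "c \<in> bounds V"
  shows "bound_subst x c b \<in> bounds V"
  using assms(1)
proof induction
  case (max bs)
  then show ?case
    by (simp add: bounds.max)
qed (use assms(2) in \<open>auto intro: bounds.intros\<close>)

text \<open>Every constructor is weakly monotonic. Induction over \<open>bounds\<close> supplies the
  side conditions for this: \<open>k > 1\<close> for powers and logarithms, and a nonempty list for
  maxima.\<close>

lemma bound_eval_le_bound_eval_subst:
  assumes "b \<in> bounds W"
    and "\<And>v. v \<noteq> x \<Longrightarrow> \<tau> v = \<sigma> v"
    and "ennreal (real_of_int (\<tau> x)) \<le> bound_eval \<sigma> c"
  shows "bound_eval \<tau> b \<le> bound_eval \<sigma> (bound_subst x c b)"
  using assms(1)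
proof induction
  case (exp k b)
  then show ?case
    \<comment> \<open>If the smaller value is infinite, so is the larger; if the larger is finite,
      \<open>enn2real\<close> is monotonic between them.\<close>
    by (auto simp: top_unique less_top intro!: ennreal_leI enn2real_mono)
next
  case (log k b)
  then show ?case
    by (auto simp: top_unique less_top intro!: ennreal_leI log_mono max.mono enn2real_mono
        simp del: ennreal_le_iff ennreal_le_iff2 log_le_cancel_iff)
next
  case (max bs)
  have "bound_eval \<tau> b \<le> Max (bound_eval \<sigma> ` bound_subst x c ` set bs)" if "b \<in> set bs" for b
    by (rule order.trans[of _ "bound_eval \<sigma> (bound_subst x c b)", OF _ Max_ge])
      (use max that in auto)
  moreover have "bs \<noteq> []"
    using max(1) by auto
  ultimately show ?case
    by (simp add: image_image)
qed (use assms(2,3) in \<open>auto intro: add_mono mult_mono\<close>)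

theorem theorem2:
  fixes V :: "'v set" and x :: 'v
    and \<phi> \<phi>x :: "'v formula" and \<eta> :: "'v \<Rightarrow> 'v int_mpoly" and q \<eta>q :: "'v int_mpoly"
  assumes "loop_over V (\<phi>, \<eta>)"
    and "poly_vars q \<subseteq> V"
    and "x \<notin> V"
    and "formula_vars \<phi>x \<subseteq> insert x V"
    and "formula_subst (poly_var(x := q)) \<phi>x = \<phi>"
    and "poly_vars \<eta>q \<subseteq> insert x V"
    and "poly_subst (poly_var(x := q)) \<eta>q = poly_subst \<eta> q"
  shows "(\<forall>\<sigma>. rc (\<phi>, \<eta>) \<sigma> = rc (\<phi>x, \<eta>(x := \<eta>q)) (\<sigma>(x := poly_subst \<sigma> q))) \<and>
    (\<forall>rb. is_runtime_bound (insert x V) (\<phi>x, \<eta>(x := \<eta>q)) rb \<longrightarrow>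
          is_runtime_bound V (\<phi>, \<eta>) (bound_subst x (poly_norm q) rb))"
proof (intro conjI allI impI)
  show rc_eq: "rc (\<phi>, \<eta>) \<sigma> = rc (\<phi>x, \<eta>(x := \<eta>q)) (\<sigma>(x := poly_subst \<sigma> q))" for \<sigma>
    using rc_fresh_var[of V \<eta> x \<phi>x \<eta>q q \<sigma>] assms by (auto simp: loop_over_def)
  fix rb
  assume rb: "is_runtime_bound (insert x V) (\<phi>x, \<eta>(x := \<eta>q)) rb"
  then have rb_bound: "rb \<in> bounds (insert x V)"
    by (simp add: is_runtime_bound_def)
  have "ennreal_of_enat (rc (\<phi>, \<eta>) \<sigma>) \<le>
      bound_eval (abs_state \<sigma>) (bound_subst x (poly_norm q) rb)" for \<sigma>
  proof -
    \<comment> \<open>The bound \<open>rb\<close> is instantiated with the state that stores the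
      value of \<open>q\<close> in \<open>x\<close>; its absolute state therefore holds the absolute
      value of that number at \<open>x\<close>, which the norm dominates.\<close>
    have "ennreal_of_enat (rc (\<phi>, \<eta>) \<sigma>) \<le> bound_eval (abs_state (\<sigma>(x := poly_subst \<sigma> q))) rb"
      using rb by (simp add: is_runtime_bound_def rc_eq)
    also have "\<dots> \<le> bound_eval (abs_state \<sigma>) (bound_subst x (poly_norm q) rb)"
      by (rule bound_eval_le_bound_eval_subst[OF rb_bound])
        (use abs_poly_subst_le_poly_norm[of \<sigma> q] in \<open>auto simp: abs_state_def\<close>)
    finally show ?thesis .
  qed
  then show "is_runtime_bound V (\<phi>, \<eta>) (bound_subst x (poly_norm q) rb)"
    using bound_subst_in_bounds[OF rb_bound poly_norm_in_bounds[OF assms(2)]]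
    by (simp add: is_runtime_bound_def)
qed

end
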